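(* Let \[ A(q,t,x)=\sum_{n\ge0}\ \sum_{\pi\in \mathfrak D^2_{2n}(3142)} q^{\mathrm{fix}(\pi)}\, t^{c_2(\pi)}\,x^n \] be the generating function for $3142$-avoiding Dumont permutations of the second kind, where $\mathrm{fix}(\pi)$ is the number of fixed points of $\pi$ and $c_2(\pi)$ is the number of 2-cycles in (the cycle decomposition of) $\pi$. Then \[ A(q,t,x)=\frac{1+x(q-t)-\sqrt{1-2x(q+t)+x^2((q+t)^2-4q)}}{2xq(1+x(1-t))}. \]
   Context: A permutation $\sigma\in\mathfrak S_N$ contains a pattern $\tau\in\mathfrak S_k$ if there are positions $i_1<\dots<i_k$ such that $(\sigma(i_1),\dots,\sigma(i_k))$ is order-isomorphic to $\tau$; otherwise $\sigma$ avoids $\tau$. A Dumont permutation of the second kind is a permutation $\pi\in\mathfrak S_{2n}$ such that $\pi(2i)<2i$ and $\pi(2i-1)\ge 2i-1$ for every $i=1,\dots,n$. $\mathfrak D^2_{2n}$ is the set of these (for $n=0$, just the empty permutation), and $\mathfrak D^2_{2n}(3142)$ is the subset of those avoiding $3142$. The identity is one of formal power series in $x$; the square root is the power series in $x$ with constant term $1$. *)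

theory Defs
  imports
    "HOL-Combinatorics.Permutations"
    "HOL-Combinatorics.Orbits"
    "HOL-Computational_Algebra.Polynomial_Factorial"
    "HOL-Computational_Algebra.Formal_Laurent_Series"
begin

text \<open>
  The symmetric group on \<open>N\<close> letters consists of the functions \<open>\<pi> :: nat \<Rightarrow> nat\<close> with
  \<open>\<pi> permutes {1..N}\<close>; in particular, positions and values are counted from 1.
\<close>

definition contains_pattern :: "nat \<Rightarrow> (nat \<Rightarrow> nat) \<Rightarrow> nat \<Rightarrow> (nat \<Rightarrow> nat) \<Rightarrow> bool" where
  "contains_pattern N \<sigma> k \<tau> \<longleftrightarrow>
     (\<exists>i :: nat \<Rightarrow> nat. strict_mono_on {1..k} i \<and> i ` {1..k} \<subseteq> {1..N} \<and>
        (\<forall>a\<in>{1..k}. \<forall>b\<in>{1..k}. \<sigma> (i a) < \<sigma> (i b) \<longleftrightarrow> \<tau> a < \<tau> b))"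

definition avoids_pattern :: "nat \<Rightarrow> (nat \<Rightarrow> nat) \<Rightarrow> nat \<Rightarrow> (nat \<Rightarrow> nat) \<Rightarrow> bool" where
  "avoids_pattern N \<sigma> k \<tau> \<longleftrightarrow> \<not> contains_pattern N \<sigma> k \<tau>"

definition one_line :: "nat list \<Rightarrow> nat \<Rightarrow> nat" where
  "one_line xs j = (if j \<in> {1..length xs} then xs ! (j - 1) else j)"

lemma one_line_3142_permutes: "one_line [3, 1, 4, 2] permutes {1..4}"
proof (rule bij_imp_permutes)
  have *: "{1..4} = {1, 2, 3, 4 :: nat}" by auto
  have "inj_on (one_line [3, 1, 4, 2]) {1..4}"
    unfolding * by (simp add: one_line_def)
  moreover have "one_line [3, 1, 4, 2] ` {1..4} = {1..4}"
    unfolding * by (auto simp: one_line_def)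
  ultimately show "bij_betw (one_line [3, 1, 4, 2]) {1..4} {1..4}"
    by (simp add: bij_betw_def)
qed (auto simp: one_line_def)

text \<open>The index \<open>n\<close> is half the size: \<open>dumont2 n\<close> is a set of permutations of \<open>{1..2 * n}\<close>.\<close>

definition dumont2 :: "nat \<Rightarrow> (nat \<Rightarrow> nat) set" where
  "dumont2 n = {\<pi>. \<pi> permutes {1..2 * n} \<and>
     (\<forall>i\<in>{1..n}. \<pi> (2 * i) < 2 * i \<and> \<pi> (2 * i - 1) \<ge> 2 * i - 1)}"

definition dumont2_avoiding_3142 :: "nat \<Rightarrow> (nat \<Rightarrow> nat) set" where
  "dumont2_avoiding_3142 n =
     {\<pi> \<in> dumont2 n. avoids_pattern (2 * n) \<pi> 4 (one_line [3, 1, 4, 2])}"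

lemma finite_dumont2_avoiding_3142: "finite (dumont2_avoiding_3142 n)"
proof (rule finite_subset)
  show "dumont2_avoiding_3142 n \<subseteq> {\<pi>. \<pi> permutes {1..2 * n}}"
    by (auto simp: dumont2_avoiding_3142_def dumont2_def)
qed (simp add: finite_permutations)

definition num_fixpoints :: "nat \<Rightarrow> (nat \<Rightarrow> nat) \<Rightarrow> nat" where
  "num_fixpoints N \<pi> = card {i \<in> {1..N}. \<pi> i = i}"

text \<open>The cycles in the cycle decomposition, fixed points included, correspond to the orbits.\<close>

definition num_2cycles :: "nat \<Rightarrow> (nat \<Rightarrow> nat) \<Rightarrow> nat" where
  "num_2cycles N \<pi> = card {C \<in> orbit \<pi> ` {1..N}. card C = 2}"

definition dumont2_gf :: "'a::comm_semiring_1 \<Rightarrow> 'a \<Rightarrow> 'a fps" where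
  "dumont2_gf q t = Abs_fps (\<lambda>n.
     \<Sum>\<pi>\<in>dumont2_avoiding_3142 n. q ^ num_fixpoints (2 * n) \<pi> * t ^ num_2cycles (2 * n) \<pi>)"

text \<open>
  For a series with constant term 1, this is the square root with constant term 1;
  the first argument of \<^const>\<open>fps_radical\<close> merely selects the constant term of the root.
\<close>

definition fps_sqrt1 :: "'a::field_char_0 fps \<Rightarrow> 'a fps" where
  "fps_sqrt1 f = fps_radical (\<lambda>_ _. 1) 2 f"

lemma fps_sqrt1_iff:
  fixes f s :: "'a::field_char_0 fps"
  assumes "fps_nth f 0 = 1"
  shows "s = fps_sqrt1 f \<longleftrightarrow> s ^ 2 = f \<and> fps_nth s 0 = 1"
proof -
  have "fps_sqrt1 f ^ Suc 1 = f"
    using power_radical[of f "\<lambda>_ _. 1" 1] assms by (simp add: fps_sqrt1_def numeral_2_eq_2)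
  moreover have "fps_nth (fps_sqrt1 f) 0 = 1"
    by (simp add: fps_sqrt1_def)
  moreover have "s = fps_sqrt1 f" if "s ^ Suc 1 = f" "fps_nth s 0 = 1"
    using radical_unique[of "\<lambda>_ _. 1" 1 f s] that assms
    by (simp add: fps_sqrt1_def numeral_2_eq_2)
  ultimately show ?thesis
    by (auto simp: numeral_2_eq_2)
qed

text \<open>
  The indeterminates of the rational function field \<open>\<rat>(q,t)\<close>, represented as the fraction
  field of \<open>\<int>[q][t]\<close>: the inner polynomial variable is \<open>q\<close>, the outer one is \<open>t\<close>.
\<close>

definition ind_q :: "int poly poly fract" where
  "ind_q = to_fract [:[:0, 1:]:]"

definition ind_t :: "int poly poly fract" where
  "ind_t = to_fract [:0, 1:]"

end

theory Submission
  imports Defs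
begin

text \<open>
  Let \<open>\<pi>\<close> be a nonempty 3142-avoiding Dumont permutation of the second kind and \<open>K = \<pi>(1)\<close>. Then
  \<open>\<pi>(2) = 1\<close>, so avoidance of 3142 puts all values below \<open>K\<close> before all values above \<open>K\<close>: \<open>\<pi>\<close> is
  the direct sum of \<open>K, 1, \<tau> + 1\<close> and a smaller such permutation \<open>\<sigma>\<close>, where \<open>\<tau>\<close> is an arbitrary
  reverse-complement of such a permutation. Fixed points and 2-cycles of \<open>\<pi>\<close> inside the first
  summand are solutions of \<open>\<tau>(i) = i + 1\<close>, and of \<open>\<tau>(i) = j + 1, \<tau>(j) = i + 1\<close>, except for the
  2-cycle \<open>(1 2)\<close> when \<open>K = 2\<close>. Let \<open>F\<close> enumerate the \<open>\<tau>\<close> by these shifted statistics; then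
  \<open>A = 1 + x (t + F - 1) A\<close>. Under reverse-complement the same decomposition applies to \<open>F\<close>; the
  shifts cancel and each first summand contributes one factor \<open>q\<close>, from its entry 1 in position 2:
  \<open>F = 1 + x q A F\<close>. Eliminating \<open>F\<close> gives
  \<open>x q (1 + x (1 - t)) A\<^sup>2 - (1 + x (q - t)) A + 1 = 0\<close>, whose solution as a power series is the claim.
\<close>

section \<open>Elementary form of 3142-avoidance and of the Dumont condition\<close>

lemma contains_3142_iff:
  "contains_pattern N \<pi> 4 (one_line [3, 1, 4, 2]) \<longleftrightarrow>
    (\<exists>a b c d. 1 \<le> a \<and> a < b \<and> b < c \<and> c < d \<and> d \<le> N \<and> \<pi> b < \<pi> d \<and> \<pi> d < \<pi> a \<and> \<pi> a < \<pi> c)"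
proof -
  have 4: "{1..4} = {1, 2, 3, 4 :: nat}" by auto
  have vals: "one_line [3, 1, 4, 2] 1 = 3" "one_line [3, 1, 4, 2] 2 = 1"
    "one_line [3, 1, 4, 2] 3 = 4" "one_line [3, 1, 4, 2] 4 = 2"
    by (simp_all add: one_line_def)
  show ?thesis
  proof
    assume "contains_pattern N \<pi> 4 (one_line [3, 1, 4, 2])"
    then obtain i :: "nat \<Rightarrow> nat" where i: "strict_mono_on {1..4} i" "i ` {1..4} \<subseteq> {1..N}"
      and *: "\<forall>a\<in>{1..4}. \<forall>b\<in>{1..4}. \<pi> (i a) < \<pi> (i b) \<longleftrightarrow>
        one_line [3, 1, 4, 2] a < one_line [3, 1, 4, 2] b"
      unfolding contains_pattern_def by blast
    have "i 1 < i 2" "i 2 < i 3" "i 3 < i 4"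
      using i(1) by (auto simp: strict_mono_on_def)
    moreover have "i 1 \<in> {1..N}" "i 4 \<in> {1..N}"
      by (rule subsetD[OF i(2)], rule imageI, simp)+
    then have "1 \<le> i 1" "i 4 \<le> N" by auto
    moreover have "\<pi> (i 2) < \<pi> (i 4)" "\<pi> (i 4) < \<pi> (i 1)" "\<pi> (i 1) < \<pi> (i 3)"
      using * by (simp_all add: 4 vals del: One_nat_def)
    ultimately show "\<exists>a b c d. 1 \<le> a \<and> a < b \<and> b < c \<and> c < d \<and> d \<le> N \<and>
        \<pi> b < \<pi> d \<and> \<pi> d < \<pi> a \<and> \<pi> a < \<pi> c" by blast
  next
    assume "\<exists>a b c d. 1 \<le> a \<and> a < b \<and> b < c \<and> c < d \<and> d \<le> N \<and>
        \<pi> b < \<pi> d \<and> \<pi> d < \<pi> a \<and> \<pi> a < \<pi> c"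
    then obtain a b c d where *: "1 \<le> a" "a < b" "b < c" "c < d" "d \<le> N"
      "\<pi> b < \<pi> d" "\<pi> d < \<pi> a" "\<pi> a < \<pi> c" by blast
    \<comment> \<open>The word \<open>[a, b, c, d]\<close> in one-line notation serves as the
      embedding of the pattern positions 1 to 4.\<close>
    have "strict_mono_on {1..4} (one_line [a, b, c, d])"
      unfolding strict_mono_on_def 4 using * by (auto simp: one_line_def)
    moreover have "one_line [a, b, c, d] ` {1..4} \<subseteq> {1..N}"
      unfolding 4 using * by (auto simp: one_line_def)
    moreover have "\<forall>x\<in>{1..4}. \<forall>y\<in>{1..4}.
        \<pi> (one_line [a, b, c, d] x) < \<pi> (one_line [a, b, c, d] y) \<longleftrightarrow>
        one_line [3, 1, 4, 2] x < one_line [3, 1, 4, 2] y"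
      unfolding 4 using * by (simp add: one_line_def)
    ultimately show "contains_pattern N \<pi> 4 (one_line [3, 1, 4, 2])"
      unfolding contains_pattern_def by blast
  qed
qed

definition av3142 :: "nat \<Rightarrow> (nat \<Rightarrow> nat) \<Rightarrow> bool" where
  "av3142 N \<pi> \<longleftrightarrow> (\<forall>a b c d. 1 \<le> a \<longrightarrow> a < b \<longrightarrow> b < c \<longrightarrow> c < d \<longrightarrow> d \<le> N \<longrightarrow>
     \<not> (\<pi> b < \<pi> d \<and> \<pi> d < \<pi> a \<and> \<pi> a < \<pi> c))"

lemma av3142D:
  assumes "av3142 N \<pi>" "1 \<le> a" "a < b" "b < c" "c < d" "d \<le> N"
    "\<pi> b < \<pi> d" "\<pi> d < \<pi> a" "\<pi> a < \<pi> c"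
  shows False
  using assms unfolding av3142_def by blast

lemma av3142I:
  assumes "\<And>a b c d. \<lbrakk>1 \<le> a; a < b; b < c; c < d; d \<le> N; \<pi> b < \<pi> d; \<pi> d < \<pi> a; \<pi> a < \<pi> c\<rbrakk> \<Longrightarrow> False"
  shows "av3142 N \<pi>"
  using assms unfolding av3142_def by blast

text \<open>At odd positions \<open>\<pi> i \<ge> i\<close> is the negation of
  \<open>\<pi> i < i\<close>, so the two families of inequalities merge into one equivalence. In
  this form, moving positions and values only requires following a parity.\<close>

lemma dumont2_avoiding_3142_iff:
  "\<pi> \<in> dumont2_avoiding_3142 n \<longleftrightarrow>
    \<pi> permutes {1..2 * n} \<and> (\<forall>i\<in>{1..2 * n}. \<pi> i < i \<longleftrightarrow> even i) \<and> av3142 (2 * n) \<pi>"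
proof -
  have "(\<forall>i\<in>{1..n}. \<pi> (2 * i) < 2 * i \<and> \<pi> (2 * i - 1) \<ge> 2 * i - 1) \<longleftrightarrow>
    (\<forall>i\<in>{1..2 * n}. \<pi> i < i \<longleftrightarrow> even i)" (is "?l \<longleftrightarrow> ?r")
  proof
    assume l: ?l
    show ?r
    proof
      fix i assume i: "i \<in> {1..2 * n}"
      show "\<pi> i < i \<longleftrightarrow> even i"
      proof (cases "even i")
        case True
        then obtain j where "i = 2 * j" by blast
        then show ?thesis using l i by auto
      next
        case False
        then obtain j where "i = 2 * j + 1" by (blast elim: oddE)
        moreover have "j + 1 \<in> {1..n}" using calculation i by auto
        ultimately show ?thesis using l False
          by (auto dest!: bspec[where x = "j + 1"])
      qed
    qed
  next
    assume r: ?r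
    show ?l
    proof
      fix i assume "i \<in> {1..n}"
      then have "2 * i \<in> {1..2 * n}" "2 * i - 1 \<in> {1..2 * n}" "odd (2 * i - 1)" by auto
      then show "\<pi> (2 * i) < 2 * i \<and> \<pi> (2 * i - 1) \<ge> 2 * i - 1"
        using r by (meson dvd_triv_left not_le)
    qed
  qed
  moreover have "avoids_pattern (2 * n) \<pi> 4 (one_line [3, 1, 4, 2]) \<longleftrightarrow> av3142 (2 * n) \<pi>"
    unfolding avoids_pattern_def contains_3142_iff av3142_def by blast
  ultimately show ?thesis
    by (auto simp: dumont2_avoiding_3142_def dumont2_def)
qed

text \<open>The reverse-complements of the members of \<^const>\<open>dumont2_avoiding_3142\<close>.\<close>

definition codumont :: "nat \<Rightarrow> (nat \<Rightarrow> nat) set" where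
  "codumont n = {\<pi>. \<pi> permutes {1..2 * n} \<and> (\<forall>i\<in>{1..2 * n}. \<pi> i \<le> i \<longleftrightarrow> even i) \<and> av3142 (2 * n) \<pi>}"

section \<open>Permutations of an initial segment and the reverse-complement\<close>

lemma permutes_atLeastAtMostI:
  fixes f :: "nat \<Rightarrow> nat"
  assumes "\<And>i. i \<in> {1..N} \<Longrightarrow> f i \<in> {1..N}" "\<And>i. i \<notin> {1..N} \<Longrightarrow> f i = i"
    and "inj_on f {1..N}"
  shows "f permutes {1..N}"
proof (rule bij_imp_permutes)
  have "f ` {1..N} = {1..N}"
    using assms by (intro endo_inj_surj) auto
  then show "bij_betw f {1..N} {1..N}" using assms by (simp add: bij_betw_def)
qed (use assms in auto)

lemma permutes_range:
  fixes f :: "nat \<Rightarrow> nat"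
  assumes "f permutes {1..N}" "1 \<le> i" "i \<le> N"
  shows "1 \<le> f i" "f i \<le> N"
  using permutes_in_image[OF assms(1), of i] assms by auto

lemma permutes_outside:
  fixes f :: "nat \<Rightarrow> nat"
  assumes "f permutes {1..N}"
  shows "f 0 = 0" "i > N \<Longrightarrow> f i = i"
  using permutes_not_in[OF assms] by auto

definition rev_compl :: "nat \<Rightarrow> (nat \<Rightarrow> nat) \<Rightarrow> nat \<Rightarrow> nat" where
  "rev_compl N \<pi> i = (if i \<in> {1..N} then N + 1 - \<pi> (N + 1 - i) else i)"

lemma rev_compl_permutes:
  assumes "\<pi> permutes {1..N}"
  shows "rev_compl N \<pi> permutes {1..N}"
proof (rule permutes_atLeastAtMostI)
  fix i assume i: "i \<in> {1..N}"
  then have "1 \<le> N + 1 - i" "N + 1 - i \<le> N" by auto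
  from permutes_range[OF assms this] show "rev_compl N \<pi> i \<in> {1..N}"
    using i by (auto simp: rev_compl_def)
next
  show "inj_on (rev_compl N \<pi>) {1..N}"
  proof (rule inj_onI)
    fix i j assume ij: "i \<in> {1..N}" "j \<in> {1..N}" "rev_compl N \<pi> i = rev_compl N \<pi> j"
    have "1 \<le> N + 1 - i" "N + 1 - i \<le> N" "1 \<le> N + 1 - j" "N + 1 - j \<le> N"
      using ij by auto
    note r = permutes_range[OF assms this(1,2)] permutes_range[OF assms this(3,4)]
    have "N + 1 - \<pi> (N + 1 - i) = N + 1 - \<pi> (N + 1 - j)"
      using ij by (simp only: rev_compl_def if_True)
    then have "\<pi> (N + 1 - i) = \<pi> (N + 1 - j)" using r by linarith
    then have "N + 1 - i = N + 1 - j" using permutes_inj[OF assms] by (auto dest: injD)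
    then show "i = j" using ij by auto
  qed
qed (auto simp: rev_compl_def)

lemma rev_compl_rev_compl:
  assumes "\<pi> permutes {1..N}"
  shows "rev_compl N (rev_compl N \<pi>) = \<pi>"
proof
  fix i
  show "rev_compl N (rev_compl N \<pi>) i = \<pi> i"
  proof (cases "i \<in> {1..N}")
    case True
    then show ?thesis using permutes_range[OF assms, of i] by (auto simp: rev_compl_def)
  next
    case False
    then show ?thesis using permutes_not_in[OF assms False] by (simp only: rev_compl_def if_False)
  qed
qed

text \<open>The pattern 3142 equals its own reverse-complement: an occurrence at a < b < c < d
  reflects to one at the positions N+1-d < N+1-c < N+1-b < N+1-a.\<close>

lemma rev_compl_av3142:
  assumes "av3142 N \<pi>"
  shows "av3142 N (rev_compl N \<pi>)"
proof (rule av3142I)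
  fix a b c d
  assume *: "1 \<le> a" "a < b" "b < c" "c < d" "d \<le> N" "rev_compl N \<pi> b < rev_compl N \<pi> d"
    "rev_compl N \<pi> d < rev_compl N \<pi> a" "rev_compl N \<pi> a < rev_compl N \<pi> c"
  have r: "\<pi> (N + 1 - j) < \<pi> (N + 1 - i)"
    if "1 \<le> i" "i \<le> N" "1 \<le> j" "j \<le> N" "rev_compl N \<pi> i < rev_compl N \<pi> j" for i j
  proof -
    have "rev_compl N \<pi> i = N + 1 - \<pi> (N + 1 - i)" "rev_compl N \<pi> j = N + 1 - \<pi> (N + 1 - j)"
      using that by (simp_all add: rev_compl_def)
    then show ?thesis using that(5) by linarith
  qed
  have N: "a \<le> N" "b \<le> N" "c \<le> N" "1 \<le> b" "1 \<le> c" "1 \<le> d" using *(1-5) by linarith+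
  show False
  proof (rule av3142D[OF assms])
    show "1 \<le> N + 1 - d" "N + 1 - d < N + 1 - c" "N + 1 - c < N + 1 - b" "N + 1 - b < N + 1 - a"
      "N + 1 - a \<le> N" using *(1-5) by linarith+
    show "\<pi> (N + 1 - c) < \<pi> (N + 1 - a)" "\<pi> (N + 1 - a) < \<pi> (N + 1 - d)"
      "\<pi> (N + 1 - d) < \<pi> (N + 1 - b)" by (rule r; fact * N)+
  qed
qed

text \<open>The reflection to 2n+1-i reverses both the inequality and the parity. Thus strict
  deficiencies at even positions become strict excedances at odd ones, and fixed points move from
  odd to even positions; hence the weak inequality in \<open>codumont\<close>.\<close>

lemma rev_compl_dumont:
  assumes "\<pi> \<in> dumont2_avoiding_3142 n"
  shows "rev_compl (2 * n) \<pi> \<in> codumont n"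
proof -
  have p: "\<pi> permutes {1..2 * n}" and D: "\<forall>i\<in>{1..2 * n}. \<pi> i < i \<longleftrightarrow> even i"
    and av: "av3142 (2 * n) \<pi>" using assms by (auto simp: dumont2_avoiding_3142_iff)
  have "rev_compl (2 * n) \<pi> i \<le> i \<longleftrightarrow> even i" if i: "i \<in> {1..2 * n}" for i
  proof -
    have j: "2 * n + 1 - i \<in> {1..2 * n}" using i by auto
    have "even (2 * n + 1 - i) \<longleftrightarrow> odd i" using i by auto
    moreover have "\<pi> (2 * n + 1 - i) < 2 * n + 1 - i \<longleftrightarrow> even (2 * n + 1 - i)"
      using D j by blast
    moreover have "rev_compl (2 * n) \<pi> i = 2 * n + 1 - \<pi> (2 * n + 1 - i)"
      using i by (simp only: rev_compl_def if_True)
    moreover have "\<pi> (2 * n + 1 - i) \<le> 2 * n" using permutes_range[OF p] j by simp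
    moreover have "i \<le> 2 * n" using i by simp
    ultimately show ?thesis by linarith
  qed
  then show ?thesis
    using rev_compl_permutes[OF p] rev_compl_av3142[OF av] by (auto simp: codumont_def)
qed

lemma rev_compl_codumont:
  assumes "\<pi> \<in> codumont n"
  shows "rev_compl (2 * n) \<pi> \<in> dumont2_avoiding_3142 n"
proof -
  have p: "\<pi> permutes {1..2 * n}" and D: "\<forall>i\<in>{1..2 * n}. \<pi> i \<le> i \<longleftrightarrow> even i"
    and av: "av3142 (2 * n) \<pi>" using assms by (auto simp: codumont_def)
  have "rev_compl (2 * n) \<pi> i < i \<longleftrightarrow> even i" if i: "i \<in> {1..2 * n}" for i
  proof -
    have j: "2 * n + 1 - i \<in> {1..2 * n}" using i by auto
    have "even (2 * n + 1 - i) \<longleftrightarrow> odd i" using i by auto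
    moreover have "\<pi> (2 * n + 1 - i) \<le> 2 * n + 1 - i \<longleftrightarrow> even (2 * n + 1 - i)"
      using D j by blast
    moreover have "rev_compl (2 * n) \<pi> i = 2 * n + 1 - \<pi> (2 * n + 1 - i)"
      using i by (simp only: rev_compl_def if_True)
    moreover have "\<pi> (2 * n + 1 - i) \<le> 2 * n" using permutes_range[OF p] j by simp
    moreover have "i \<le> 2 * n" using i by simp
    ultimately show ?thesis by linarith
  qed
  then show ?thesis
    using rev_compl_permutes[OF p] rev_compl_av3142[OF av]
    by (auto simp: dumont2_avoiding_3142_iff)
qed

section \<open>Shifted fixed points and 2-cycles\<close>

text \<open>Fixed points and 2-cycles of \<open>i \<mapsto> \<pi> i - s\<close>; raising an entry by 1 while moving it two
  places to the right turns shift \<open>s + 1\<close> into shift \<open>s\<close>.\<close>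

definition shift_fix :: "nat \<Rightarrow> int \<Rightarrow> (nat \<Rightarrow> nat) \<Rightarrow> nat set" where
  "shift_fix N s \<pi> = {i \<in> {1..N}. int (\<pi> i) = int i + s}"

definition shift_swaps :: "nat \<Rightarrow> int \<Rightarrow> (nat \<Rightarrow> nat) \<Rightarrow> (nat \<times> nat) set" where
  "shift_swaps N s \<pi> = {(i, j). 1 \<le> i \<and> i < j \<and> j \<le> N \<and> int (\<pi> i) = int j + s \<and> int (\<pi> j) = int i + s}"

definition weight :: "'a::comm_semiring_1 \<Rightarrow> 'a \<Rightarrow> nat \<Rightarrow> int \<Rightarrow> (nat \<Rightarrow> nat) \<Rightarrow> 'a" where
  "weight q t N s \<pi> = q ^ card (shift_fix N s \<pi>) * t ^ card (shift_swaps N s \<pi>)"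

lemma finite_shift_fix: "finite (shift_fix N s \<pi>)"
  by (simp add: shift_fix_def)

lemma finite_shift_swaps: "finite (shift_swaps N s \<pi>)"
  by (rule finite_subset[of _ "{1..N} \<times> {1..N}"]) (auto simp: shift_swaps_def)

text \<open>A two-element orbit is matched with the increasing pair of its members.\<close>

lemma num_2cycles_eq:
  assumes p: "\<pi> permutes {1..N}"
  shows "num_2cycles N \<pi> = card (shift_swaps N 0 \<pi>)"
proof -
  have orb: "orbit \<pi> x = {x, \<pi> x}" if "\<pi> (\<pi> x) = x" for x
  proof
    show "orbit \<pi> x \<subseteq> {x, \<pi> x}"
    proof
      fix y assume "y \<in> orbit \<pi> x"
      then show "y \<in> {x, \<pi> x}" by induction (use that in auto)
    qed
    show "{x, \<pi> x} \<subseteq> orbit \<pi> x"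
      using that orbit.base[of \<pi> x] orbit.step[OF orbit.base[of \<pi> x]] by auto
  qed
  have swap: "\<pi> (\<pi> x) = x \<and> \<pi> x \<noteq> x" if c: "card (orbit \<pi> x) = 2" for x
  proof -
    have neq: "\<pi> x \<noteq> x"
    proof
      assume "\<pi> x = x"
      then have "orbit \<pi> x = {x}" using orb[of x] by simp
      then show False using c by simp
    qed
    \<comment> \<open>\<open>orbit \<pi> x\<close> is generated from \<open>\<pi> x\<close>; it
      contains \<open>x\<close> itself because \<open>\<pi>\<close> is a permutation with finite
      support.\<close>
    have "permutation \<pi>" using p permutation_permutes by blast
    then have "x \<in> orbit \<pi> x" by (rule permutation_self_in_orbit)
    then have "{x, \<pi> x} \<subseteq> orbit \<pi> x" by (auto intro: orbit.base)
    moreover have "finite (orbit \<pi> x)" using c card.infinite by fastforce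
    ultimately have "orbit \<pi> x = {x, \<pi> x}"
      using c neq by (metis card_2_iff card_subset_eq)
    then have "\<pi> (\<pi> x) \<in> {x, \<pi> x}" by (metis orbit.base orbit.step)
    then show ?thesis using neq permutes_inj[OF p] by (auto dest: injD)
  qed
  have "bij_betw (\<lambda>(i, j). {i, j}) (shift_swaps N 0 \<pi>) {C \<in> orbit \<pi> ` {1..N}. card C = 2}"
  proof (rule bij_betwI')
    fix x y assume "x \<in> shift_swaps N 0 \<pi>" "y \<in> shift_swaps N 0 \<pi>"
    then show "((case x of (i, j) \<Rightarrow> {i, j}) = (case y of (i, j) \<Rightarrow> {i, j})) = (x = y)"
      by (auto simp: shift_swaps_def doubleton_eq_iff)
  next
    fix x assume "x \<in> shift_swaps N 0 \<pi>"
    then obtain i j where x: "x = (i, j)" "1 \<le> i" "i < j" "j \<le> N" "\<pi> i = j" "\<pi> j = i"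
      by (auto simp: shift_swaps_def)
    then have "orbit \<pi> i = {i, j}" using orb[of i] by auto
    then show "(case x of (i, j) \<Rightarrow> {i, j}) \<in> {C \<in> orbit \<pi> ` {1..N}. card C = 2}"
      using x by (auto intro!: image_eqI[of _ _ i])
  next
    fix C assume "C \<in> {C \<in> orbit \<pi> ` {1..N}. card C = 2}"
    then obtain x where x: "x \<in> {1..N}" "C = orbit \<pi> x" "card (orbit \<pi> x) = 2" by auto
    note s = swap[OF x(3)]
    have C: "C = {x, \<pi> x}" using orb s x by auto
    have "1 \<le> \<pi> x" "\<pi> x \<le> N" using permutes_range[OF p, of x] x(1) by auto
    then have "(min x (\<pi> x), max x (\<pi> x)) \<in> shift_swaps N 0 \<pi>"
      using s x(1) by (auto simp: shift_swaps_def min_def max_def)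
    moreover have "C = (case (min x (\<pi> x), max x (\<pi> x)) of (i, j) \<Rightarrow> {i, j})"
      using C by (auto simp: min_def max_def)
    ultimately show "\<exists>x\<in>shift_swaps N 0 \<pi>. C = (case x of (i, j) \<Rightarrow> {i, j})" by blast
  qed
  then show ?thesis unfolding num_2cycles_def by (simp add: bij_betw_same_card)
qed

text \<open>With j = N+1-i, the reverse-complement has value N+1-\<pi>(j) at i, which is i+s exactly
  when \<pi>(j) = j-s. Swapped pairs are reflected in the same way, with their order
  exchanged.\<close>

lemma weight_rev_compl:
  assumes p: "\<pi> permutes {1..N}"
  shows "weight q t N s (rev_compl N \<pi>) = weight q t N (- s) \<pi>"
proof -
  have 1: "int (rev_compl N \<pi> i) = int N + 1 - int (\<pi> (Suc N - i))" if "1 \<le> i" "i \<le> N" for i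
  proof -
    have "\<pi> (N + 1 - i) \<le> N" by (rule permutes_range[OF p]) (use that in auto)
    then show ?thesis using that by (simp add: rev_compl_def)
  qed
  have 2: "int (rev_compl N \<pi> (Suc N - i)) = int N + 1 - int (\<pi> i)" if "1 \<le> i" "i \<le> N" for i
  proof -
    have "Suc N - (Suc N - i) = i" using that by simp
    then show ?thesis using that 1[of "Suc N - i"] by auto
  qed
  have "bij_betw (\<lambda>i. N + 1 - i) (shift_fix N s (rev_compl N \<pi>)) (shift_fix N (- s) \<pi>)"
    by (rule bij_betw_byWitness[where f' = "\<lambda>i. N + 1 - i"])
      (auto simp: shift_fix_def 1 2 of_nat_diff)
  moreover have "bij_betw (\<lambda>(i, j). (N + 1 - j, N + 1 - i))
      (shift_swaps N s (rev_compl N \<pi>)) (shift_swaps N (- s) \<pi>)"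
    by (rule bij_betw_byWitness[where f' = "\<lambda>(i, j). (N + 1 - j, N + 1 - i)"])
      (auto simp: shift_swaps_def 1 2 of_nat_diff)
  ultimately show ?thesis by (simp add: weight_def bij_betw_same_card)
qed

lemma sum_codumont:
  "(\<Sum>\<pi>\<in>codumont n. weight q t (2 * n) s \<pi>) = (\<Sum>\<pi>\<in>dumont2_avoiding_3142 n. weight q t (2 * n) (- s) \<pi>)"
proof (rule sum.reindex_bij_witness[of _ "rev_compl (2 * n)" "rev_compl (2 * n)"])
  fix \<pi> assume "\<pi> \<in> codumont n"
  then have "\<pi> permutes {1..2 * n}" by (simp add: codumont_def)
  then show "rev_compl (2 * n) (rev_compl (2 * n) \<pi>) = \<pi>"
    "weight q t (2 * n) (- s) (rev_compl (2 * n) \<pi>) = weight q t (2 * n) s \<pi>"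
    by (simp_all add: rev_compl_rev_compl weight_rev_compl)
next
  fix \<pi> assume "\<pi> \<in> dumont2_avoiding_3142 n"
  then show "rev_compl (2 * n) (rev_compl (2 * n) \<pi>) = \<pi>"
    by (simp add: dumont2_avoiding_3142_iff rev_compl_rev_compl)
qed (auto intro: rev_compl_codumont rev_compl_dumont)

section \<open>Direct sums and caps\<close>

definition dsum :: "nat \<Rightarrow> (nat \<Rightarrow> nat) \<Rightarrow> (nat \<Rightarrow> nat) \<Rightarrow> nat \<Rightarrow> nat" where
  "dsum K \<pi> \<sigma> i = (if i \<le> K then \<pi> i else \<sigma> (i - K) + K)"

text \<open>For a permutation \<tau> of \<open>{1..M}\<close>, the result has its maximum in first
  position and is therefore indecomposable under direct sums. It is the block with which a nonempty
  3142-avoiding Dumont permutation begins.\<close>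

definition cap :: "nat \<Rightarrow> (nat \<Rightarrow> nat) \<Rightarrow> nat \<Rightarrow> nat" where
  "cap M \<tau> i = (if i = 1 then M + 2 else if i = 2 then 1
     else if i \<in> {3..M + 2} then \<tau> (i - 2) + 1 else i)"

text \<open>Both statistics compare values with positions, and the second summand has both raised by
  the same \<open>K\<close>. Only pairs straddling the two blocks need to be excluded.\<close>

lemma weight_dsum:
  assumes p: "\<pi> permutes {1..K}" and s: "\<sigma> permutes {1..M}"
  shows "weight q t (K + M) s (dsum K \<pi> \<sigma>) = weight q t K s \<pi> * weight q t M s \<sigma>"
proof -
  have "shift_fix (K + M) s (dsum K \<pi> \<sigma>) = shift_fix K s \<pi> \<union> (\<lambda>i. i + K) ` shift_fix M s \<sigma>"
    (is "?L = ?R")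
  proof
    show "?R \<subseteq> ?L" by (auto simp: shift_fix_def dsum_def)
    show "?L \<subseteq> ?R"
    proof
      fix i assume i: "i \<in> ?L"
      show "i \<in> ?R"
      proof (cases "i \<le> K")
        case False
        then have "i - K \<in> shift_fix M s \<sigma>" using i by (auto simp: shift_fix_def dsum_def)
        then show ?thesis using False by (auto intro!: image_eqI[of _ _ "i - K"])
      qed (use i in \<open>auto simp: shift_fix_def dsum_def\<close>)
    qed
  qed
  moreover have "shift_fix K s \<pi> \<inter> (\<lambda>i. i + K) ` shift_fix M s \<sigma> = {}"
    by (auto simp: shift_fix_def)
  ultimately have 1: "card (shift_fix (K + M) s (dsum K \<pi> \<sigma>))
      = card (shift_fix K s \<pi>) + card (shift_fix M s \<sigma>)"
    by (simp add: card_Un_disjoint card_image finite_shift_fix)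
  have "shift_swaps (K + M) s (dsum K \<pi> \<sigma>) =
      shift_swaps K s \<pi> \<union> (\<lambda>(i, j). (i + K, j + K)) ` shift_swaps M s \<sigma>"
    (is "?L = ?R")
  proof
    show "?R \<subseteq> ?L" by (auto simp: shift_swaps_def dsum_def)
    show "?L \<subseteq> ?R"
    proof
      fix z assume z: "z \<in> ?L"
      obtain i j where ij: "z = (i, j)" by force
      consider "j \<le> K" | "i > K" | "i \<le> K" "j > K" by linarith
      then show "z \<in> ?R"
      proof cases
        case 1
        then show ?thesis using z by (auto simp: shift_swaps_def dsum_def ij)
      next
        case 2
        then have "(i - K, j - K) \<in> shift_swaps M s \<sigma>"
          using z by (auto simp: shift_swaps_def dsum_def ij)
        then show ?thesis using 2 z ij
          by (auto simp: shift_swaps_def intro!: image_eqI[of _ _ "(i - K, j - K)"])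
      next
        \<comment> \<open>Here the value j+s at i is at most K < j, so s < 0, while the value i+s at
          j exceeds K \<ge> i, so s > 0.\<close>
        case 3
        then show ?thesis
          using z ij permutes_range[OF p, of i] permutes_range[OF s, of "j - K"]
          by (auto simp: shift_swaps_def dsum_def)
      qed
    qed
  qed
  moreover have "shift_swaps K s \<pi> \<inter> (\<lambda>(i, j). (i + K, j + K)) ` shift_swaps M s \<sigma> = {}"
    by (auto simp: shift_swaps_def)
  moreover have "inj_on (\<lambda>(i, j). (i + K, j + K)) (shift_swaps M s \<sigma>)"
    by (auto simp: inj_on_def)
  ultimately have 2: "card (shift_swaps (K + M) s (dsum K \<pi> \<sigma>))
      = card (shift_swaps K s \<pi>) + card (shift_swaps M s \<sigma>)"
    by (simp add: card_Un_disjoint card_image finite_shift_swaps)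
  show ?thesis by (simp add: weight_def 1 2 power_add mult_ac)
qed

lemma cap_simps:
  "cap M \<tau> (Suc 0) = M + 2" "cap M \<tau> 2 = 1" "cap M \<tau> 0 = 0"
  "1 \<le> i \<Longrightarrow> i \<le> M \<Longrightarrow> cap M \<tau> (Suc (Suc i)) = \<tau> i + 1"
  by (auto simp: cap_def)

lemma shift_2_cases:
  fixes i :: nat
  obtains "i = 0" | "i = 1" | "i = 2" | j where "i = Suc (Suc j)" "1 \<le> j"
proof -
  have "i = 0 \<or> i = 1 \<or> i = 2 \<or> (i = Suc (Suc (i - 2)) \<and> 1 \<le> i - 2)" by linarith
  then show thesis using that by blast
qed

lemma cap_permutes:
  assumes p: "\<tau> permutes {1..M}"
  shows "cap M \<tau> permutes {1..M + 2}"
proof (rule permutes_atLeastAtMostI)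
  have r: "1 \<le> \<tau> i \<and> \<tau> i \<le> M" if "1 \<le> i" "i \<le> M" for i
    using permutes_range[OF p] that by blast
  show "cap M \<tau> i \<in> {1..M + 2}" if "i \<in> {1..M + 2}" for i
    using that r[of "i - 2"] by (cases i rule: shift_2_cases) (auto simp: cap_simps)
  show "inj_on (cap M \<tau>) {1..M + 2}"
  proof (rule inj_onI)
    fix i j assume ij: "i \<in> {1..M + 2}" "j \<in> {1..M + 2}" "cap M \<tau> i = cap M \<tau> j"
    then show "i = j"
      using r[of "i - 2"] r[of "j - 2"] permutes_inj[OF p]
      by (cases i rule: shift_2_cases; cases j rule: shift_2_cases)
        (auto simp: cap_simps dest: injD)
  qed
qed (auto simp: cap_def)

lemma dsum_range:
  assumes "\<pi> permutes {1..K}" "\<sigma> permutes {1..M}"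
  shows "i \<le> K \<Longrightarrow> dsum K \<pi> \<sigma> i \<le> K"
    and "K < i \<Longrightarrow> K < dsum K \<pi> \<sigma> i"
proof -
  show "dsum K \<pi> \<sigma> i \<le> K" if "i \<le> K"
    using that permutes_range[OF assms(1), of i] permutes_outside(1)[OF assms(1)]
    by (cases "i = 0") (auto simp: dsum_def)
  show "K < dsum K \<pi> \<sigma> i" if "K < i"
  proof -
    have "1 \<le> i - K" using that by simp
    then have "1 \<le> \<sigma> (i - K)"
      using permutes_range(1)[OF assms(2), of "i - K"] permutes_outside(2)[OF assms(2), of "i - K"]
      by (cases "i - K \<le> M") auto
    then show ?thesis using that by (simp add: dsum_def)
  qed
qed

lemma dsum_permutes:
  assumes p: "\<pi> permutes {1..K}" and s: "\<sigma> permutes {1..M}"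
  shows "dsum K \<pi> \<sigma> permutes {1..K + M}"
proof (rule permutes_atLeastAtMostI)
  show "dsum K \<pi> \<sigma> i \<in> {1..K + M}" if "i \<in> {1..K + M}" for i
  proof (cases "i \<le> K")
    case True
    then show ?thesis using that permutes_range[OF p, of i] by (auto simp: dsum_def)
  next
    case False
    then have "1 \<le> i - K" "i - K \<le> M" using that by auto
    then show ?thesis using False permutes_range[OF s, of "i - K"] by (auto simp: dsum_def)
  qed
  show "dsum K \<pi> \<sigma> i = i" if "i \<notin> {1..K + M}" for i
    using that permutes_outside(1)[OF p] permutes_outside(2)[OF s, of "i - K"]
    by (cases "i = 0") (auto simp: dsum_def)
  show "inj_on (dsum K \<pi> \<sigma>) {1..K + M}"
  proof (rule inj_onI)
    fix i j assume eq: "dsum K \<pi> \<sigma> i = dsum K \<pi> \<sigma> j"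
    then have "i \<le> K \<longleftrightarrow> j \<le> K" using dsum_range[OF p s] by (metis not_le)
    with eq have "\<pi> i = \<pi> j \<and> i \<le> K \<and> j \<le> K \<or> \<sigma> (i - K) = \<sigma> (j - K) \<and> i > K \<and> j > K"
      by (auto simp: dsum_def)
    then show "i = j"
      using injD[OF permutes_inj[OF p], of i j] injD[OF permutes_inj[OF s], of "i - K" "j - K"] by auto
  qed
qed

text \<open>An occurrence cannot begin at position 1, which holds the maximum, as the 4 must exceed
  the 3; nor at position 2, which holds the minimum. So it lies inside \<tau>.\<close>

lemma av3142_cap:
  assumes "av3142 M \<tau>" "\<tau> permutes {1..M}"
  shows "av3142 (M + 2) (cap M \<tau>)"
proof (rule av3142I)
  fix a b c d
  assume *: "1 \<le> a" "a < b" "b < c" "c < d" "d \<le> M + 2"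
    "cap M \<tau> b < cap M \<tau> d" "cap M \<tau> d < cap M \<tau> a" "cap M \<tau> a < cap M \<tau> c"
  have sh: "cap M \<tau> i = \<tau> (i - 2) + 1" if "3 \<le> i" "i \<le> M + 2" for i
    using that by (auto simp: cap_def)
  show False
  proof (cases "a \<le> 2")
    case True
    then consider "a = 1" | "a = 2" using *(1) by linarith
    then show False
    proof cases
      case 1
      moreover have "cap M \<tau> c \<le> M + 2"
        using * permutes_range(2)[OF cap_permutes[OF assms(2)], of c] by linarith
      ultimately show False using * by (simp add: cap_simps)
    next
      case 2
      then show False using * by (simp add: cap_simps)
    qed
  next
    case False
    have "cap M \<tau> a = \<tau> (a - 2) + 1" "cap M \<tau> b = \<tau> (b - 2) + 1"
      "cap M \<tau> c = \<tau> (c - 2) + 1" "cap M \<tau> d = \<tau> (d - 2) + 1"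
      by (rule sh; use False *(1-5) in linarith)+
    then have v: "\<tau> (b - 2) < \<tau> (d - 2)" "\<tau> (d - 2) < \<tau> (a - 2)" "\<tau> (a - 2) < \<tau> (c - 2)"
      using *(6-8) by simp_all
    show False
      by (rule av3142D[OF assms(1) _ _ _ _ _ v]) (use False *(1-5) in linarith)+
  qed
qed

text \<open>The pattern 3142 is indecomposable: its first entry exceeds its last, so if the last
  lies in the upper block, the first does too, and with it the whole occurrence.\<close>

lemma av3142_dsum:
  assumes p: "\<pi> permutes {1..K}" and s: "\<sigma> permutes {1..M}"
    and "av3142 K \<pi>" "av3142 M \<sigma>"
  shows "av3142 (K + M) (dsum K \<pi> \<sigma>)"
proof (rule av3142I)
  fix a b c d
  assume *: "1 \<le> a" "a < b" "b < c" "c < d" "d \<le> K + M"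
    "dsum K \<pi> \<sigma> b < dsum K \<pi> \<sigma> d" "dsum K \<pi> \<sigma> d < dsum K \<pi> \<sigma> a" "dsum K \<pi> \<sigma> a < dsum K \<pi> \<sigma> c"
  show False
  proof (cases "d \<le> K")
    case True
    show False
      by (rule av3142D[OF assms(3), of a b c d]) (use True * in \<open>auto simp: dsum_def\<close>)
  next
    case False
    then have "a > K" using * dsum_range[OF p s, of a] dsum_range[OF p s, of d]
      by linarith
    have v: "\<sigma> (b - K) < \<sigma> (d - K)" "\<sigma> (d - K) < \<sigma> (a - K)" "\<sigma> (a - K) < \<sigma> (c - K)"
      using *(2-4,6-8) \<open>a > K\<close> by (simp_all add: dsum_def)
    show False
      by (rule av3142D[OF assms(4) _ _ _ _ _ v]) (use \<open>a > K\<close> *(1-5) in linarith)+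
  qed
qed

section \<open>Unique decomposition of Dumont permutations\<close>

text \<open>At position j+2 the cap has value \<tau>(j)+1, which is below j+2 exactly when \<tau>(j)
  \<le> j: this is why \<tau> ranges over \<open>codumont\<close>. The first block has even length,
  so parities in \<sigma> are preserved.\<close>

lemma dsum_cap_dumont:
  assumes "\<tau> \<in> codumont m" "\<sigma> \<in> dumont2_avoiding_3142 r"
  shows "dsum (2 * m + 2) (cap (2 * m) \<tau>) \<sigma> \<in> dumont2_avoiding_3142 (Suc (m + r))"
proof -
  have t: "\<tau> permutes {1..2 * m}" "\<forall>i\<in>{1..2 * m}. \<tau> i \<le> i \<longleftrightarrow> even i" "av3142 (2 * m) \<tau>"
    using assms by (auto simp: codumont_def)
  have s: "\<sigma> permutes {1..2 * r}" "\<forall>i\<in>{1..2 * r}. \<sigma> i < i \<longleftrightarrow> even i" "av3142 (2 * r) \<sigma>"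
    using assms by (auto simp: dumont2_avoiding_3142_iff)
  note c = cap_permutes[OF t(1)]
  have eq: "2 * Suc (m + r) = 2 * m + 2 + 2 * r" by simp
  have cap: "cap (2 * m) \<tau> i < i \<longleftrightarrow> even i" if "i \<in> {1..2 * m + 2}" for i
  proof (cases i rule: shift_2_cases)
    case (4 j)
    then have j: "j \<in> {1..2 * m}" using that by simp
    with t(2) have "\<tau> j \<le> j \<longleftrightarrow> even j" by blast
    then show ?thesis using j by (simp add: 4 cap_simps less_Suc_eq_le)
  qed (use that in \<open>simp_all add: cap_simps\<close>)
  have "dsum (2 * m + 2) (cap (2 * m) \<tau>) \<sigma> i < i \<longleftrightarrow> even i" if "i \<in> {1..2 * m + 2 + 2 * r}" for i
  proof (cases "i \<le> 2 * m + 2")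
    case True
    then show ?thesis using cap that by (simp add: dsum_def)
  next
    case False
    define j where "j = i - (2 * m + 2)"
    have j: "i = j + (2 * m + 2)" "j \<in> {1..2 * r}" using False that by (auto simp: j_def)
    then have "\<sigma> j < j \<longleftrightarrow> even j" using s(2) by blast
    then show ?thesis using j by (simp add: dsum_def)
  qed
  then show ?thesis
    unfolding dumont2_avoiding_3142_iff eq
    using dsum_permutes[OF c s(1)] av3142_dsum[OF c s(1) av3142_cap[OF t(3,1)] s(3)] by blast
qed

lemma dumont_decompose:
  assumes "\<pi> \<in> dumont2_avoiding_3142 (Suc n)"
  obtains m \<tau> \<sigma> where "m \<le> n" "\<tau> \<in> codumont m" "\<sigma> \<in> dumont2_avoiding_3142 (n - m)"
    "\<pi> = dsum (2 * m + 2) (cap (2 * m) \<tau>) \<sigma>"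
proof -
  define N where "N = 2 * Suc n"
  have p: "\<pi> permutes {1..N}" and D: "\<And>i. 1 \<le> i \<Longrightarrow> i \<le> N \<Longrightarrow> \<pi> i < i \<longleftrightarrow> even i"
    and av: "av3142 N \<pi>" using assms by (auto simp: dumont2_avoiding_3142_iff N_def)
  note inj = injD[OF permutes_inj[OF p]]
  have N: "even N" "2 \<le> N" by (auto simp: N_def)
  define K where "K = \<pi> 1"
  have 2: "\<pi> 2 = 1" using D[of 2] permutes_range[OF p, of 2] N by auto
  have K: "1 \<le> K" "K \<le> N" using permutes_range[OF p, of 1] N by (auto simp: K_def)
  have "K \<noteq> 1" using inj[of 1 2] 2 by (auto simp: K_def)
  with K have K2: "2 \<le> K" by simp
  \<comment> \<open>An entry above \<open>K\<close> followed by one below \<open>K\<close> forms 3142 with the initial entries \<open>K 1\<close>.\<close>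
  have gt: "K < \<pi> j" if "K < \<pi> i" "i < j" "1 \<le> i" "j \<le> N" for i j
  proof (rule ccontr)
    assume "\<not> K < \<pi> j"
    have i: "i \<noteq> 1" "i \<noteq> 2" using that(1) 2 K by (auto simp: K_def)
    have "\<pi> j \<noteq> K" using inj[of j 1] that by (auto simp: K_def)
    moreover have "\<pi> j \<noteq> 1" using inj[of j 2] that i 2 by auto
    moreover have "1 \<le> \<pi> j" using permutes_range[OF p, of j] that by auto
    ultimately have "1 < \<pi> j" "\<pi> j < K" using \<open>\<not> K < \<pi> j\<close> by auto
    then show False
      using av3142D[OF av, of 1 2 i j] that i 2 by (auto simp: K_def)
  qed
  \<comment> \<open>Pigeonhole: if a value above K stood at a position i \<le> K, then by
    \<open>gt\<close> all of 1, ..., K would have to stand in the i-1 < K places before it.\<close>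
  have low: "\<pi> i \<le> K" if i: "1 \<le> i" "i \<le> K" for i
  proof (rule ccontr)
    assume c: "\<not> \<pi> i \<le> K"
    have "{1..K} \<subseteq> \<pi> ` {1..<i}"
    proof
      fix v assume v: "v \<in> {1..K}"
      then have "v \<in> \<pi> ` {1..N}" using permutes_image[OF p] K by auto
      then obtain j where j: "j \<in> {1..N}" "v = \<pi> j" by blast
      have "j \<noteq> i" "\<not> i < j" using gt[of i j] c v j i by auto
      then have "j < i" by simp
      then show "v \<in> \<pi> ` {1..<i}" using j by auto
    qed
    then have "card {1..K} \<le> card (\<pi> ` {1..<i})" by (intro card_mono) auto
    also have "\<dots> \<le> card {1..<i}" by (rule card_image_le) simp
    finally show False using i by simp
  qed
  have "\<pi> ` {1..K} \<subseteq> {1..K}"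
    using low permutes_range[OF p] K by auto
  then have img: "\<pi> ` {1..K} = {1..K}"
    by (intro endo_inj_surj) (auto intro: inj_on_subset[OF permutes_inj[OF p]])
  have high: "K < \<pi> i" if "K < i" "i \<le> N" for i
  proof (rule ccontr)
    assume "\<not> K < \<pi> i"
    then have "\<pi> i \<in> \<pi> ` {1..K}" using permutes_range[OF p, of i] that unfolding img by auto
    then obtain x where "x \<le> K" "\<pi> i = \<pi> x" by auto
    then show False using inj[of i x] that by auto
  qed
  \<comment> \<open>At an odd K the Dumont condition and \<open>low\<close> would make K a fixed
    point, but the value K already occurs at position 1.\<close>
  have "even K"
  proof (rule ccontr)
    assume "odd K"
    then have "\<pi> K = K" using D[of K] K low[of K] by auto
    then show False using inj[of K 1] K2 by (auto simp: K_def)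
  qed
  define m where "m = K div 2 - 1"
  have Km: "K = 2 * m + 2" using \<open>even K\<close> K2 by (auto simp: m_def elim!: evenE)
  have m: "m \<le> n" using K Km by (simp add: N_def)
  have NK: "N = K + 2 * (n - m)" using m by (simp add: N_def Km)
  define \<tau> where "\<tau> i = (if i \<in> {1..2 * m} then \<pi> (i + 2) - 1 else i)" for i
  define \<sigma> where "\<sigma> i = (if i = 0 then 0 else \<pi> (i + K) - K)" for i
  \<comment> \<open>The values K and 1 are taken by positions 1 and 2, so the entries at positions 3
    to K lie strictly between them and the natural subtraction in \<tau> does not truncate.\<close>
  have tau: "\<pi> (i + 2) = \<tau> i + 1" "1 \<le> \<tau> i" "\<tau> i \<le> 2 * m" if "1 \<le> i" "i \<le> 2 * m" for i
  proof -
    have "\<pi> (i + 2) \<noteq> 1" using inj[of "i + 2" 2] 2 that by auto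
    moreover have "\<pi> (i + 2) \<noteq> K" using inj[of "i + 2" 1] that by (auto simp: K_def)
    moreover have "1 \<le> \<pi> (i + 2)" using permutes_range[OF p, of "i + 2"] that K Km by auto
    moreover have "\<pi> (i + 2) \<le> K" using low[of "i + 2"] that Km by auto
    ultimately show "\<pi> (i + 2) = \<tau> i + 1" "1 \<le> \<tau> i" "\<tau> i \<le> 2 * m"
      using that Km by (auto simp: \<tau>_def)
  qed
  \<comment> \<open>This also covers positions beyond N, where \<pi> is the identity.\<close>
  have sigma: "\<pi> (i + K) = \<sigma> i + K" "1 \<le> \<sigma> i" if "1 \<le> i" for i
  proof -
    have "K < \<pi> (i + K)"
      using high[of "i + K"] that permutes_outside(2)[OF p, of "i + K"] by (cases "i + K \<le> N") auto
    then show "\<pi> (i + K) = \<sigma> i + K" "1 \<le> \<sigma> i" using that by (auto simp: \<sigma>_def)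
  qed
  have sigma_le: "\<sigma> i \<le> 2 * (n - m)" if "1 \<le> i" "i \<le> 2 * (n - m)" for i
    using sigma[of i] that permutes_range[OF p, of "i + K"] NK by auto
  have \<tau>: "\<tau> \<in> codumont m"
  proof -
    have "\<tau> permutes {1..2 * m}"
    proof (rule permutes_atLeastAtMostI)
      show "inj_on \<tau> {1..2 * m}"
      proof (rule inj_onI)
        fix i j assume "i \<in> {1..2 * m}" "j \<in> {1..2 * m}" "\<tau> i = \<tau> j"
        then have "\<pi> (i + 2) = \<pi> (j + 2)" using tau[of i] tau[of j] by auto
        then show "i = j" using inj by fastforce
      qed
    qed (use tau in \<open>auto simp: \<tau>_def\<close>)
    moreover have "\<tau> i \<le> i \<longleftrightarrow> even i" if "i \<in> {1..2 * m}" for i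
      using that D[of "i + 2"] tau[of i] Km K by auto
    moreover have "av3142 (2 * m) \<tau>"
    proof (rule av3142I)
      fix a b c d assume *: "1 \<le> a" "a < b" "b < c" "c < d" "d \<le> 2 * m"
        "\<tau> b < \<tau> d" "\<tau> d < \<tau> a" "\<tau> a < \<tau> c"
      show False
        by (rule av3142D[OF av, of "a + 2" "b + 2" "c + 2" "d + 2"])
          (use * tau(1)[of a] tau(1)[of b] tau(1)[of c] tau(1)[of d] K Km in auto)
    qed
    ultimately show ?thesis by (simp add: codumont_def)
  qed
  have \<sigma>: "\<sigma> \<in> dumont2_avoiding_3142 (n - m)"
  proof -
    have "\<sigma> permutes {1..2 * (n - m)}"
    proof (rule permutes_atLeastAtMostI)
      show "\<sigma> i \<in> {1..2 * (n - m)}" if "i \<in> {1..2 * (n - m)}" for i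
        using that sigma sigma_le by auto
      show "\<sigma> i = i" if "i \<notin> {1..2 * (n - m)}" for i
        using that permutes_outside(2)[OF p, of "i + K"] NK by (auto simp: \<sigma>_def)
      show "inj_on \<sigma> {1..2 * (n - m)}"
      proof (rule inj_onI)
        fix i j assume "i \<in> {1..2 * (n - m)}" "j \<in> {1..2 * (n - m)}" "\<sigma> i = \<sigma> j"
        then have "\<pi> (i + K) = \<pi> (j + K)" using sigma[of i] sigma[of j] by auto
        then show "i = j" using inj by fastforce
      qed
    qed
    moreover have "\<sigma> i < i \<longleftrightarrow> even i" if "i \<in> {1..2 * (n - m)}" for i
      using that D[of "i + K"] sigma(1)[of i] \<open>even K\<close> NK by auto
    moreover have "av3142 (2 * (n - m)) \<sigma>"
    proof (rule av3142I)
      fix a b c d assume *: "1 \<le> a" "a < b" "b < c" "c < d" "d \<le> 2 * (n - m)"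
        "\<sigma> b < \<sigma> d" "\<sigma> d < \<sigma> a" "\<sigma> a < \<sigma> c"
      show False
        by (rule av3142D[OF av, of "a + K" "b + K" "c + K" "d + K"])
          (use * sigma(1)[of a] sigma(1)[of b] sigma(1)[of c] sigma(1)[of d] NK in auto)
    qed
    ultimately show ?thesis by (simp add: dumont2_avoiding_3142_iff)
  qed
  have "\<pi> = dsum (2 * m + 2) (cap (2 * m) \<tau>) \<sigma>"
  proof
    fix i
    show "\<pi> i = dsum (2 * m + 2) (cap (2 * m) \<tau>) \<sigma> i"
    proof (cases "i \<le> K")
      case True
      then show ?thesis
        using 2 K_def Km permutes_outside(1)[OF p] tau(1)[of "i - 2"]
        by (cases i rule: shift_2_cases) (auto simp: dsum_def cap_simps)
    next
      case False
      then have "\<pi> i = \<sigma> (i - K) + K" using sigma(1)[of "i - K"] by simp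
      then show ?thesis using False by (simp add: dsum_def Km)
    qed
  qed
  with m \<tau> \<sigma> that show thesis by blast
qed

text \<open>The first entry, M+2, reveals where the block ends; \<tau> and \<sigma> can then be read
  off entry by entry.\<close>

lemma dsum_cap_inject:
  assumes "\<tau> permutes {1..M}" "\<tau>' permutes {1..M'}" "\<sigma> permutes {1..L}" "\<sigma>' permutes {1..L'}"
    and eq: "dsum (M + 2) (cap M \<tau>) \<sigma> = dsum (M' + 2) (cap M' \<tau>') \<sigma>'"
  shows "M = M' \<and> \<tau> = \<tau>' \<and> \<sigma> = \<sigma>'"
proof -
  note e = fun_cong[OF eq]
  have M: "M = M'" using e[of 1] by (simp add: dsum_def cap_simps)
  moreover have "\<tau> i = \<tau>' i" for i
  proof (cases "i \<in> {1..M}")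
    case True
    then show ?thesis using e[of "i + 2"] by (simp add: dsum_def cap_simps M)
  next
    case False
    then show ?thesis using permutes_not_in[OF assms(1)] permutes_not_in[OF assms(2)] M by simp
  qed
  moreover have "\<sigma> i = \<sigma>' i" for i
  proof (cases "i = 0")
    case True
    then show ?thesis using permutes_outside(1)[OF assms(3)] permutes_outside(1)[OF assms(4)] by simp
  next
    case False
    then show ?thesis using e[of "i + M + 2"] by (simp add: dsum_def M)
  qed
  ultimately show ?thesis by auto
qed

text \<open>The decomposition as a change of summation index, for an arbitrary summand so that it
  serves every shift.\<close>

lemma sum_dumont_Suc:
  fixes g :: "(nat \<Rightarrow> nat) \<Rightarrow> 'a::comm_monoid_add"
  shows "(\<Sum>\<pi>\<in>dumont2_avoiding_3142 (Suc n). g \<pi>) =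
    (\<Sum>m\<le>n. \<Sum>\<tau>\<in>codumont m. \<Sum>\<sigma>\<in>dumont2_avoiding_3142 (n - m).
       g (dsum (2 * m + 2) (cap (2 * m) \<tau>) \<sigma>))"
proof -
  let ?f = "\<lambda>(m, \<tau>, \<sigma>). dsum (2 * m + 2) (cap (2 * m) \<tau>) \<sigma>"
  let ?A = "SIGMA m:{..n}. codumont m \<times> dumont2_avoiding_3142 (n - m)"
  have fin: "finite (codumont m)" for m
    by (rule finite_subset[of _ "{\<pi>. \<pi> permutes {1..2 * m}}"])
      (auto simp: codumont_def finite_permutations)
  have "inj_on ?f ?A"
  proof (rule inj_onI)
    fix x y assume xy: "x \<in> ?A" "y \<in> ?A" "?f x = ?f y"
    obtain m \<tau> \<sigma> m' \<tau>' \<sigma>' where e: "x = (m, \<tau>, \<sigma>)" "y = (m', \<tau>', \<sigma>')" by (metis prod.collapse)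
    have "\<tau> permutes {1..2 * m}" "\<tau>' permutes {1..2 * m'}"
      "\<sigma> permutes {1..2 * (n - m)}" "\<sigma>' permutes {1..2 * (n - m')}"
      using xy e by (auto simp: codumont_def dumont2_avoiding_3142_iff)
    from dsum_cap_inject[OF this] show "x = y" using xy(3) e by simp
  qed
  moreover have "?f ` ?A = dumont2_avoiding_3142 (Suc n)"
  proof
    show "?f ` ?A \<subseteq> dumont2_avoiding_3142 (Suc n)"
    proof
      fix \<pi> assume "\<pi> \<in> ?f ` ?A"
      then obtain m \<tau> \<sigma> where *: "m \<le> n" "\<tau> \<in> codumont m" "\<sigma> \<in> dumont2_avoiding_3142 (n - m)"
        "\<pi> = dsum (2 * m + 2) (cap (2 * m) \<tau>) \<sigma>" by auto
      then show "\<pi> \<in> dumont2_avoiding_3142 (Suc n)" using dsum_cap_dumont[OF *(2,3)] by simp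
    qed
    show "dumont2_avoiding_3142 (Suc n) \<subseteq> ?f ` ?A"
    proof
      fix \<pi> assume "\<pi> \<in> dumont2_avoiding_3142 (Suc n)"
      then obtain m \<tau> \<sigma> where *: "m \<le> n" "\<tau> \<in> codumont m" "\<sigma> \<in> dumont2_avoiding_3142 (n - m)"
        "\<pi> = dsum (2 * m + 2) (cap (2 * m) \<tau>) \<sigma>" by (rule dumont_decompose)
      then show "\<pi> \<in> ?f ` ?A" by (intro image_eqI[of _ _ "(m, \<tau>, \<sigma>)"]) auto
    qed
  qed
  ultimately have "(\<Sum>\<pi>\<in>dumont2_avoiding_3142 (Suc n). g \<pi>) = (\<Sum>x\<in>?A. g (?f x))"
    by (metis (no_types, lifting) sum.reindex_cong)
  also have "\<dots> = (\<Sum>m\<le>n. \<Sum>(\<tau>, \<sigma>)\<in>codumont m \<times> dumont2_avoiding_3142 (n - m).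
       g (dsum (2 * m + 2) (cap (2 * m) \<tau>) \<sigma>))"
    using fin finite_dumont2_avoiding_3142
    by (subst sum.Sigma) (auto intro!: sum.cong)
  finally show ?thesis by (simp add: sum.cartesian_product)
qed

section \<open>Effect of a cap on the shifted statistics\<close>

lemma shift_swaps_cap_image:
  assumes "i > 2" "(i, j) \<in> shift_swaps (M + 2) s (cap M \<tau>)"
  shows "(i, j) \<in> (\<lambda>(i, j). (i + 2, j + 2)) ` shift_swaps M (s + 1) \<tau>"
proof -
  have "3 \<le> i" "i < j" "j \<le> M + 2" using assms by (simp_all add: shift_swaps_def)
  then obtain i' j' where e: "i = Suc (Suc i')" "j = Suc (Suc j')" "1 \<le> i'" "i' < j'" "j' \<le> M"
    by (cases i rule: shift_2_cases; cases j rule: shift_2_cases) auto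
  then have "(i', j') \<in> shift_swaps M (s + 1) \<tau>"
    using assms(2) by (auto simp: shift_swaps_def cap_simps)
  then show ?thesis using e by (auto intro!: image_eqI[of _ _ "(i', j')"])
qed

text \<open>A pair starting at 1 needs M+2 = j+s with j \<le> M+2, hence s = 0 and j = M+2; the
  entry at j must then be 1, which stands at position 2, so M = 0. A pair starting at 2 needs 1 =
  j+s with j \<ge> 3, impossible for s \<ge> -1.\<close>

lemma shift_swaps_cap:
  assumes t: "\<tau> permutes {1..M}" and s: "s \<in> {0, -1}"
  shows "shift_swaps (M + 2) s (cap M \<tau>) = (\<lambda>(i, j). (i + 2, j + 2)) ` shift_swaps M (s + 1) \<tau> \<union>
    (if s = 0 \<and> M = 0 then {(1, 2)} else {})" (is "?L = ?R")
proof
  show "?R \<subseteq> ?L" by (auto simp: shift_swaps_def cap_simps)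
  show "?L \<subseteq> ?R"
  proof
    fix z assume z: "z \<in> ?L"
    obtain i j where ij: "z = (i, j)" by force
    consider "i = 0" | "i = 1" | "i = 2" | "i > 2" by linarith
    then show "z \<in> ?R"
    proof cases
      case 2
      then have "int M + 2 = int j + s" "j \<le> M + 2" using z ij by (auto simp: shift_swaps_def cap_simps)
      then have "s = 0" "j = M + 2" using s by auto
      moreover have "M = 0"
      proof (rule ccontr)
        assume "M \<noteq> 0"
        then have "cap M \<tau> (M + 2) = \<tau> M + 1" "1 \<le> \<tau> M" using permutes_range[OF t, of M]
          by (auto simp: cap_simps)
        then show False using z 2 \<open>j = M + 2\<close> \<open>s = 0\<close> ij by (auto simp: shift_swaps_def)
      qed
      ultimately show ?thesis using ij 2 by simp
    qed (use z ij s shift_swaps_cap_image[of i j M s \<tau>] in \<open>auto simp: shift_swaps_def cap_simps\<close>)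
  qed
qed

text \<open>Position 2 with its entry 1 counts exactly for s = -1; the maximum at position 1 is too
  large to count for either shift.\<close>

lemma shift_fix_cap:
  assumes s: "s \<in> {0, -1}"
  shows "shift_fix (M + 2) s (cap M \<tau>) = (\<lambda>i. i + 2) ` shift_fix M (s + 1) \<tau> \<union>
    (if s = 0 then {} else {2})" (is "?L = ?R")
proof
  show "?R \<subseteq> ?L" using s by (auto simp: shift_fix_def cap_simps)
  show "?L \<subseteq> ?R"
  proof
    fix i assume i: "i \<in> ?L"
    then show "i \<in> ?R" using s by (cases i rule: shift_2_cases) (auto simp: shift_fix_def cap_simps)
  qed
qed

text \<open>The cap over the empty permutation is the transposition (1 2) and weighs t instead of 1.
  This exception causes the term t - 1 in the equation for A.\<close>

lemma weight_cap_0: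
  assumes "\<tau> permutes {1..M}"
  shows "weight q t (M + 2) 0 (cap M \<tau>) = (if M = 0 then t else weight q t M 1 \<tau>)"
proof -
  have "inj_on (\<lambda>(i, j). (i + 2, j + 2 :: nat)) (shift_swaps M 1 \<tau>)" by (auto simp: inj_on_def)
  then have "card ((\<lambda>(i, j). (i + 2, j + 2)) ` shift_swaps M 1 \<tau>) = card (shift_swaps M 1 \<tau>)"
    by (rule card_image)
  moreover have "card ((\<lambda>i. i + 2) ` shift_fix M 1 \<tau>) = card (shift_fix M 1 \<tau>)"
    by (rule card_image) (simp add: inj_on_def)
  moreover have "shift_fix 0 1 \<tau> = {}" "shift_swaps 0 1 \<tau> = {}"
    by (auto simp: shift_fix_def shift_swaps_def)
  ultimately show ?thesis
    using shift_swaps_cap[OF assms, of 0] shift_fix_cap[of 0 M \<tau>]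
    by (cases "M = 0") (simp_all add: weight_def)
qed

lemma weight_cap_neg1:
  assumes "\<tau> permutes {1..M}"
  shows "weight q t (M + 2) (- 1) (cap M \<tau>) = q * weight q t M 0 \<tau>"
proof -
  have "inj_on (\<lambda>(i, j). (i + 2, j + 2 :: nat)) (shift_swaps M 0 \<tau>)" by (auto simp: inj_on_def)
  moreover have "2 \<notin> (\<lambda>i. i + 2) ` shift_fix M 0 \<tau>" by (auto simp: shift_fix_def)
  moreover have "card ((\<lambda>i. i + 2) ` shift_fix M 0 \<tau>) = card (shift_fix M 0 \<tau>)"
    by (rule card_image) (simp add: inj_on_def)
  ultimately show ?thesis
    using shift_swaps_cap[OF assms, of "-1"] shift_fix_cap[of "-1" M \<tau>]
    by (simp add: weight_def card_image finite_shift_fix mult_ac)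
qed

section \<open>Functional equations for the two generating functions\<close>

lemma sum_weight_Suc:
  "(\<Sum>\<pi>\<in>dumont2_avoiding_3142 (Suc n). weight q t (2 * Suc n) s \<pi>) =
    (\<Sum>m\<le>n. (\<Sum>\<tau>\<in>codumont m. weight q t (2 * m + 2) s (cap (2 * m) \<tau>)) *
      (\<Sum>\<sigma>\<in>dumont2_avoiding_3142 (n - m). weight q t (2 * (n - m)) s \<sigma>))"
proof -
  have "weight q t (2 * Suc n) s (dsum (2 * m + 2) (cap (2 * m) \<tau>) \<sigma>) =
      weight q t (2 * m + 2) s (cap (2 * m) \<tau>) * weight q t (2 * (n - m)) s \<sigma>"
    if "m \<le> n" "\<tau> \<in> codumont m" "\<sigma> \<in> dumont2_avoiding_3142 (n - m)" for m \<tau> \<sigma>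
  proof -
    have "2 * Suc n = 2 * m + 2 + 2 * (n - m)" using that by simp
    moreover have "\<tau> permutes {1..2 * m}" "\<sigma> permutes {1..2 * (n - m)}"
      using that by (simp_all add: codumont_def dumont2_avoiding_3142_iff)
    ultimately show ?thesis by (simp only: weight_dsum[OF cap_permutes])
  qed
  then show ?thesis
    unfolding sum_dumont_Suc sum_product by (intro sum.cong refl) simp_all
qed

lemma dumont_0: "dumont2_avoiding_3142 0 = {id}"
  by (auto simp: dumont2_avoiding_3142_iff av3142_def)

lemma codumont_0: "codumont 0 = {id}"
  by (auto simp: codumont_def av3142_def)

lemma weight_0: "weight q t 0 s \<pi> = 1"
proof -
  have "shift_swaps 0 s \<pi> = {}" by (auto simp: shift_swaps_def)
  then show ?thesis by (simp add: weight_def shift_fix_def)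
qed

lemma dumont2_gf_nth:
  "fps_nth (dumont2_gf q t) n = (\<Sum>\<pi>\<in>dumont2_avoiding_3142 n. weight q t (2 * n) 0 \<pi>)"
  by (auto simp: dumont2_gf_def weight_def num_fixpoints_def shift_fix_def
      dumont2_avoiding_3142_iff num_2cycles_eq intro!: sum.cong)

text \<open>The shift \<open>-1\<close> on Dumont permutations is, by reverse-complement, the shift \<open>1\<close> on
  \<open>codumont n\<close>: this is the enumerator of the permutations \<open>\<tau>\<close> under a cap.\<close>

definition shifted_gf :: "'a::comm_semiring_1 \<Rightarrow> 'a \<Rightarrow> 'a fps" where
  "shifted_gf q t = Abs_fps (\<lambda>n. \<Sum>\<pi>\<in>dumont2_avoiding_3142 n. weight q t (2 * n) (- 1) \<pi>)"

lemma dumont2_gf_eq: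
  fixes q t :: "'a::comm_ring_1"
  shows "dumont2_gf q t = 1 + fps_X * ((shifted_gf q t - 1 + fps_const t) * dumont2_gf q t)"
proof (rule fps_ext)
  fix n
  \<comment> \<open>Subtracting 1 and adding t replaces the constant term 1 of
    \<open>shifted_gf q t\<close> by the weight t of the exceptional cap.\<close>
  have B: "(\<Sum>\<tau>\<in>codumont m. weight q t (2 * m + 2) 0 (cap (2 * m) \<tau>)) =
      fps_nth (shifted_gf q t - 1 + fps_const t) m" for m
  proof -
    have "(\<Sum>\<tau>\<in>codumont m. weight q t (2 * m + 2) 0 (cap (2 * m) \<tau>)) =
        (\<Sum>\<tau>\<in>codumont m. if m = 0 then t else weight q t (2 * m) 1 \<tau>)"
      by (intro sum.cong refl, subst weight_cap_0) (auto simp: codumont_def)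
    also have "\<dots> = fps_nth (shifted_gf q t - 1 + fps_const t) m"
      by (cases "m = 0") (simp_all add: codumont_0 dumont_0 weight_0 sum_codumont shifted_gf_def)
    finally show ?thesis .
  qed
  show "fps_nth (dumont2_gf q t) n =
      fps_nth (1 + fps_X * ((shifted_gf q t - 1 + fps_const t) * dumont2_gf q t)) n"
  proof (cases n)
    case 0
    then show ?thesis by (simp add: dumont2_gf_nth dumont_0 weight_0)
  next
    case (Suc k)
    have "fps_nth (dumont2_gf q t) n =
        (\<Sum>m\<le>k. fps_nth (shifted_gf q t - 1 + fps_const t) m * fps_nth (dumont2_gf q t) (k - m))"
      unfolding Suc dumont2_gf_nth sum_weight_Suc B ..
    also have "\<dots> = fps_nth ((shifted_gf q t - 1 + fps_const t) * dumont2_gf q t) k"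
      by (simp only: fps_mult_nth atLeast0AtMost)
    finally show ?thesis by (simp add: Suc)
  qed
qed

text \<open>Under a cap, shift -1 becomes shift 0 on \<open>codumont\<close>, and reverse-complement
  identifies shift 0 there with the unshifted statistics on Dumont permutations. So the first block
  contributes q A, while the remaining summand keeps shift -1.\<close>

lemma shifted_gf_eq:
  fixes q t :: "'a::comm_ring_1"
  shows "shifted_gf q t = 1 + fps_X * (fps_const q * dumont2_gf q t * shifted_gf q t)"
proof (rule fps_ext)
  fix n
  have B: "(\<Sum>\<tau>\<in>codumont m. weight q t (2 * m + 2) (- 1) (cap (2 * m) \<tau>)) =
      fps_nth (fps_const q * dumont2_gf q t) m" for m
  proof -
    have "(\<Sum>\<tau>\<in>codumont m. weight q t (2 * m + 2) (- 1) (cap (2 * m) \<tau>)) =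
        (\<Sum>\<tau>\<in>codumont m. q * weight q t (2 * m) 0 \<tau>)"
      by (intro sum.cong refl, subst weight_cap_neg1) (auto simp: codumont_def)
    then show ?thesis
      by (simp add: sum_distrib_left[symmetric] sum_codumont dumont2_gf_nth)
  qed
  show "fps_nth (shifted_gf q t) n =
      fps_nth (1 + fps_X * (fps_const q * dumont2_gf q t * shifted_gf q t)) n"
  proof (cases n)
    case 0
    then show ?thesis by (simp add: shifted_gf_def dumont_0 weight_0)
  next
    case (Suc k)
    have "fps_nth (shifted_gf q t) n =
        (\<Sum>m\<le>k. fps_nth (fps_const q * dumont2_gf q t) m * fps_nth (shifted_gf q t) (k - m))"
      unfolding Suc shifted_gf_def fps_nth_Abs_fps sum_weight_Suc B ..
    also have "\<dots> = fps_nth (fps_const q * dumont2_gf q t * shifted_gf q t) k"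
      by (simp only: fps_mult_nth[of _ "shifted_gf q t"] atLeast0AtMost)
    finally show ?thesis by (simp add: Suc)
  qed
qed

section \<open>Elimination and solution of the quadratic equation\<close>

lemma dumont2_gf_quadratic:
  fixes q t :: "'a::comm_ring_1"
  defines "A \<equiv> dumont2_gf q t" and "Q \<equiv> fps_const q" and "T \<equiv> fps_const t"
  shows "fps_X * Q * (1 + fps_X * (1 - T)) * A ^ 2 - (1 + fps_X * (Q - T)) * A + 1 = 0"
proof -
  define F where "F = shifted_gf q t"
  have A: "A = 1 + fps_X * ((F - 1 + T) * A)" and F: "F = 1 + fps_X * (Q * A * F)"
    using dumont2_gf_eq[of q t] shifted_gf_eq[of q t] by (simp_all add: A_def F_def Q_def T_def)
  \<comment> \<open>The multipliers \<open>1 - fps_X * Q * A\<close> and \<open>fps_X * A\<close> of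
    the two equations are chosen so that all terms containing F cancel.\<close>
  have "fps_X * Q * (1 + fps_X * (1 - T)) * A ^ 2 - (1 + fps_X * (Q - T)) * A + 1
    = (1 - fps_X * Q * A) * (1 + fps_X * ((F - 1 + T) * A) - A)
      - fps_X * A * (F - (fps_X * (Q * A * F)) - 1)"
    by (simp add: algebra_simps power2_eq_square)
  also have "\<dots> = 0" using A F by (simp add: algebra_simps)
  finally show ?thesis .
qed

text \<open>The denominator has constant term 0 and is no unit among power series, so the quotient
  is taken among Laurent series.\<close>

lemma dumont2_gf_closed_form:
  fixes q t :: "'a::field_char_0"
  assumes "q \<noteq> 0"
  defines "Q \<equiv> fps_const q" and "T \<equiv> fps_const t"
  shows "fps_to_fls (dumont2_gf q t) =
    fps_to_fls (1 + fps_X * (Q - T)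
      - fps_sqrt1 (1 - 2 * fps_X * (Q + T) + fps_X ^ 2 * ((Q + T) ^ 2 - 4 * Q)))
    / fps_to_fls (2 * fps_X * Q * (1 + fps_X * (1 - T)))"
proof -
  define A where "A = dumont2_gf q t"
  define D where "D = 2 * fps_X * Q * (1 + fps_X * (1 - T))"
  define S where "S = 1 - 2 * fps_X * (Q + T) + fps_X ^ 2 * ((Q + T) ^ 2 - 4 * Q)"
  \<comment> \<open>Completing the square: S is the discriminant of the quadratic and r the
    candidate root. As D has constant term 0, r has constant term 1, which fixes the sign of the
    square root.\<close>
  define r where "r = 1 + fps_X * (Q - T) - D * A"
  have quad: "fps_X * Q * (1 + fps_X * (1 - T)) * A ^ 2 - (1 + fps_X * (Q - T)) * A + 1 = 0"
    unfolding A_def Q_def T_def by (rule dumont2_gf_quadratic)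
  have "r ^ 2 - S = 2 * D * (fps_X * Q * (1 + fps_X * (1 - T)) * A ^ 2 - (1 + fps_X * (Q - T)) * A + 1)"
    unfolding r_def S_def D_def by (simp add: algebra_simps power2_eq_square)
  then have "r ^ 2 = S" using quad by simp
  moreover have "fps_nth r 0 = 1" by (simp add: r_def D_def mult.assoc)
  moreover have "fps_nth S 0 = 1" by (simp add: S_def mult.assoc power2_eq_square)
  ultimately have r: "r = fps_sqrt1 S" using fps_sqrt1_iff by blast
  have num: "1 + fps_X * (Q - T) - fps_sqrt1 S = D * A"
    unfolding r[symmetric] r_def by simp
  \<comment> \<open>Factoring out x exhibits the coefficient 2q of x in D, which is nonzero in
    characteristic 0, so D may be cancelled.\<close>
  have "D = fps_X * (2 * Q * (1 + fps_X * (1 - T)))" by (simp add: D_def mult_ac)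
  then have "fps_nth D 1 = 2 * q"
    by (simp add: Q_def fps_numeral_nth_0 mult.assoc)
  then have "D \<noteq> 0" using assms(1) by auto
  then have "fps_to_fls (D * A) / fps_to_fls D = fps_to_fls A"
    by (simp add: fls_times_fps_to_fls)
  then show ?thesis unfolding A_def[symmetric] S_def[symmetric] D_def[symmetric] num by simp
qed

theorem theorem3p2:
  shows "let q = fps_const ind_q; t = fps_const ind_t; x = fps_X in
    fps_to_fls (dumont2_gf ind_q ind_t) =
      fps_to_fls (1 + x * (q - t)
         - fps_sqrt1 (1 - 2 * x * (q + t) + x ^ 2 * ((q + t) ^ 2 - 4 * q)))
      / fps_to_fls (2 * x * q * (1 + x * (1 - t)))"
proof -
  have "ind_q \<noteq> 0" by (simp add: ind_q_def)
  from dumont2_gf_closed_form[OF this] show ?thesis by (simp only: Let_def)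
qed

end
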